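(* Let $w_{1},w_{2},w_{3}$ be any odd positive integers and $n\ge0$ an integer. Then for all $y_1,y_2$ the following six expressions are equal: \begin{align*} &w_{1}^{n}\sum_{k=0}^{n}\binom{n}{k}E_{k}(w_{3}y_{1})\sum_{i=0}^{w_{1}-1}(-1)^iE_{n-k}\Big(w_{2}y_{2}+\frac{w_{2}}{w_{1}}i\Big)w_{3}^{n-k}w_{2}^{k}\\ =&w_{1}^{n}\sum_{k=0}^{n}\binom{n}{k}E_{k}(w_{2}y_{1})\sum_{i=0}^{w_{1}-1}(-1)^iE_{n-k}\Big(w_{3}y_{2}+\frac{w_{3}}{w_{1}}i\Big)w_{2}^{n-k}w_{3}^{k}\\ =&w_{2}^{n}\sum_{k=0}^{n}\binom{n}{k}E_{k}(w_{3}y_{1})\sum_{i=0}^{w_{2}-1}(-1)^iE_{n-k}\Big(w_{1}y_{2}+\frac{w_{1}}{w_{2}}i\Big)w_{3}^{n-k}w_{1}^{k}\\ =&w_{2}^{n}\sum_{k=0}^{n}\binom{n}{k}E_{k}(w_{1}y_{1})\sum_{i=0}^{w_{2}-1}(-1)^iE_{n-k}\Big(w_{3}y_{2}+\frac{w_{3}}{w_{2}}i\Big)w_{1}^{n-k}w_{3}^{k}\\ =&w_{3}^{n}\sum_{k=0}^{n}\binom{n}{k}E_{k}(w_{2}y_{1})\sum_{i=0}^{w_{3}-1}(-1)^iE_{n-k}\Big(w_{1}y_{2}+\frac{w_{1}}{w_{3}}i\Big)w_{2}^{n-k}w_{1}^{k}\\ =&w_{3}^{n}\sum_{k=0}^{n}\binom{n}{k}E_{k}(w_{1}y_{1})\sum_{i=0}^{w_{3}-1}(-1)^iE_{n-k}\Big(w_{2}y_{2}+\frac{w_{2}}{w_{3}}i\Big)w_{1}^{n-k}w_{2}^{k}.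 \end{align*}
   Context: The Euler polynomials $E_n(x)$ are defined by $\frac{2}{e^{t}+1}e^{xt}=\sum_{n=0}^{\infty}E_{n}(x)\frac{t^{n}}{n!}$. *)

theory Defs
  imports "HOL-Computational_Algebra.Formal_Power_Series"
begin

definition Euler_gf :: "'a::field_char_0 \<Rightarrow> 'a fps" where
  "Euler_gf x = 2 / (fps_exp 1 + 1) * fps_exp x"

definition Euler_poly :: "nat \<Rightarrow> 'a::field_char_0 \<Rightarrow> 'a" where
  "Euler_poly n x = fact n * fps_nth (Euler_gf x) n"

text \<open>The quotient in \<open>Euler_gf\<close> is a genuine one, because the denominator has constant
  term 2 and hence is a unit.\<close>

lemma Euler_gf_denominator: "(fps_exp 1 + 1) * Euler_gf x = 2 * fps_exp (x::'a::field_char_0)"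
proof -
  have "fps_nth (fps_exp 1 + 1 :: 'a fps) 0 \<noteq> 0" by simp
  then have "2 / (fps_exp 1 + 1) * (fps_exp 1 + 1) = (2 :: 'a fps)"
    by (simp add: fps_divide_unit mult.assoc inverse_mult_eq_1)
  then show ?thesis unfolding Euler_gf_def by (metis mult.assoc mult.commute)
qed

lemma Euler_gf_eq: "Euler_gf x = Abs_fps (\<lambda>n. Euler_poly n x / fact n)"
  by (simp add: fps_eq_iff Euler_poly_def)

end

theory Submission
  imports Defs
begin

text \<open>Each of the six sums is \<open>n!\<close> times the \<open>n\<close>-th coefficient of one series that is symmetric
  in the three weights. Substituting \<open>w\<^sub>1w\<^sub>2t\<close> and \<open>w\<^sub>1w\<^sub>3t\<close> for \<open>t\<close> in the generating
  function, the binomial convolution becomes a product, and for odd \<open>w\<^sub>1\<close> the alternating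
  sum over \<open>i\<close> is a geometric sum with value
  \<open>(exp(w\<^sub>1w\<^sub>2w\<^sub>3t) + 1) / (exp(w\<^sub>2w\<^sub>3t) + 1)\<close>. The result is
  \<open>4 exp(w\<^sub>1w\<^sub>2w\<^sub>3(y\<^sub>1+y\<^sub>2)t) (exp(w\<^sub>1w\<^sub>2w\<^sub>3t) + 1)\<close> divided by
  \<open>(exp(w\<^sub>1w\<^sub>2t) + 1) (exp(w\<^sub>1w\<^sub>3t) + 1) (exp(w\<^sub>2w\<^sub>3t) + 1)\<close>.\<close>

text \<open>This is \<open>Euler_gf x\<close> with \<open>c * t\<close> in place of
  \<open>t\<close>, given by coefficients so that they can be read off directly in products.\<close>

definition scaled_Euler_gf :: "'a::field_char_0 \<Rightarrow> 'a \<Rightarrow> 'a fps" where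
  "scaled_Euler_gf c x = Abs_fps (\<lambda>n. c ^ n * (Euler_poly n x / fact n))"

lemma scaled_Euler_gf_denominator:
  "(fps_exp c + 1) * scaled_Euler_gf c x = 2 * fps_exp (c * x)"
proof -
  let ?cX = "fps_const c * fps_X"
  have two: "fps_compose (2 :: 'a fps) ?cX = 2"
    by (metis fps_const_compose numeral_fps_const)
  have gf: "fps_compose (Euler_gf x) ?cX = scaled_Euler_gf c x"
    by (simp add: fps_compose_linear scaled_Euler_gf_def Euler_gf_eq)
  have "fps_compose ((fps_exp 1 + 1) * Euler_gf x) ?cX = fps_compose (2 * fps_exp x) ?cX"
    by (simp only: Euler_gf_denominator)
  then show ?thesis
    by (simp add: fps_compose_mult_distrib fps_compose_add_distrib two gf
        fps_exp_compose_linear)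
qed

lemma alternating_geometric_sum:
  fixes x :: "'a::comm_ring_1"
  assumes "odd w"
  shows "(x + 1) * (\<Sum>i=0..w - 1. (-1) ^ i * x ^ i) = x ^ w + 1"
proof -
  \<comment> \<open>The sum telescopes for every upper limit \<open>m\<close>. Oddness of
    \<open>w\<close> matters only at \<open>m = w - 1\<close>, where the last sign becomes
    \<open>+1\<close>.\<close>
  have "(x + 1) * (\<Sum>i=0..m. (-1) ^ i * x ^ i) = 1 + (-1) ^ m * x ^ Suc m" for m
    by (induction m) (simp_all add: algebra_simps)
  from this[of "w - 1"] show ?thesis
    using assms by (simp add: odd_pos)
qed

text \<open>Scaling by \<open>a * c\<close> turns the shift \<open>b / a * i\<close> into the
  exponent \<open>i * (b * c)\<close>, so the summands form a geometric progression with ratio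
  \<open>- fps_exp (b * c)\<close>.\<close>

lemma alternating_scaled_Euler_gf:
  fixes y :: "'a::field_char_0"
  assumes "odd a"
  shows "(fps_exp (of_nat b * of_nat c) + 1) * (fps_exp (of_nat a * of_nat c) + 1) *
      (\<Sum>i=0..a - 1. (-1) ^ i *
        scaled_Euler_gf (of_nat a * of_nat c) (of_nat b * y + of_nat b / of_nat a * of_nat i)) =
    2 * fps_exp (of_nat a * of_nat b * of_nat c * y) *
      (fps_exp (of_nat a * of_nat b * of_nat c) + 1)"
    (is "(?X + 1) * ?D * (\<Sum>i=_.._. _ * ?G i) = 2 * ?Y * _")
proof -
  have a: "(of_nat a :: 'a) \<noteq> 0"
    using assms by (simp add: odd_pos)
  have G: "?D * ?G i = 2 * ?Y * ?X ^ i" for i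
  proof -
    have "of_nat a * of_nat c * (of_nat b * y + of_nat b / of_nat a * of_nat i) =
        of_nat a * of_nat b * of_nat c * y + of_nat i * (of_nat b * of_nat c)"
      using a by (simp add: field_simps)
    then show ?thesis
      by (simp add: scaled_Euler_gf_denominator fps_exp_add_mult fps_exp_power_mult mult.assoc)
  qed
  have "(?X + 1) * ?D * (\<Sum>i=0..a - 1. (-1) ^ i * ?G i) =
      (?X + 1) * (\<Sum>i=0..a - 1. (-1) ^ i * (?D * ?G i))"
    by (simp add: sum_distrib_left mult_ac)
  also have "\<dots> = 2 * ?Y * ((?X + 1) * (\<Sum>i=0..a - 1. (-1) ^ i * ?X ^ i))"
    by (simp only: G) (simp add: sum_distrib_left mult_ac)
  also have "\<dots> = 2 * ?Y * (?X ^ a + 1)"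
    by (simp only: alternating_geometric_sum[OF assms])
  finally show ?thesis
    by (simp add: fps_exp_power_mult mult.assoc)
qed

text \<open>The weights regroup as \<open>(a * b) ^ k * (a * c) ^ (n - k)\<close>, which makes the
  sum a Cauchy product. The right-hand side is visibly invariant under permuting \<open>a\<close>,
  \<open>b\<close>, \<open>c\<close>.\<close>

lemma Euler_poly_convolution_eq_coeff:
  fixes y1 y2 :: "'a::field_char_0"
  assumes "odd a"
  shows "of_nat a ^ n * (\<Sum>k=0..n. of_nat (n choose k) * Euler_poly k (of_nat c * y1) *
      (\<Sum>i=0..a - 1. (-1) ^ i *
        Euler_poly (n - k) (of_nat b * y2 + of_nat b / of_nat a * of_nat i)) *
      of_nat c ^ (n - k) * of_nat b ^ k) =
    fact n * fps_nth (4 * fps_exp (of_nat a * of_nat b * of_nat c * (y1 + y2)) *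
      (fps_exp (of_nat a * of_nat b * of_nat c) + 1) *
      inverse ((fps_exp (of_nat a * of_nat b) + 1) * (fps_exp (of_nat a * of_nat c) + 1) *
        (fps_exp (of_nat b * of_nat c) + 1))) n"
    (is "_ = fact n * fps_nth (?N * inverse ?D) n")
proof -
  let ?x = "\<lambda>i. of_nat b * y2 + of_nat b / of_nat a * of_nat i :: 'a"
  define G where "G = scaled_Euler_gf (of_nat a * of_nat b :: 'a) (of_nat c * y1)"
  define T where "T = (\<Sum>i=0..a - 1. (-1) ^ i * scaled_Euler_gf (of_nat a * of_nat c :: 'a) (?x i))"
  \<comment> \<open>As constant series, the signs pass through coefficient extraction.\<close>
  have sgn: "(-1 :: 'a fps) ^ i = fps_const ((-1) ^ i)" for i
    by (metis fps_const_1_eq_1 fps_const_neg fps_const_power)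
  have T_nth: "fps_nth T m = (of_nat a * of_nat c) ^ m / fact m *
      (\<Sum>i=0..a - 1. (-1) ^ i * Euler_poly m (?x i))" for m
    unfolding T_def
    by (simp add: fps_sum_nth sgn scaled_Euler_gf_def sum_distrib_left mult_ac)
  \<comment> \<open>The first factor of \<open>?D\<close> clears the denominator of
    \<open>G\<close>, the other two those of \<open>T\<close>.\<close>
  have "?D * (G * T) = ((fps_exp (of_nat a * of_nat b) + 1) * G) *
      ((fps_exp (of_nat b * of_nat c) + 1) * (fps_exp (of_nat a * of_nat c) + 1) * T)"
    by (simp only: mult_ac)
  also have "\<dots> = ?N"
    unfolding G_def T_def scaled_Euler_gf_denominator alternating_scaled_Euler_gf[OF assms]
    by (simp add: distrib_left fps_exp_add_mult mult_ac)
  finally have "?N * inverse ?D = ?D * (G * T) * inverse ?D"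
    by (rule arg_cong[OF sym])
  also have "\<dots> = G * T * (inverse ?D * ?D)"
    by (simp only: mult_ac)
  also have "inverse ?D * ?D = 1"
    \<comment> \<open>The constant term of \<open>?D\<close> is 8, nonzero in characteristic
      0.\<close>
    by (rule inverse_mult_eq_1) simp
  finally have series: "?N * inverse ?D = G * T"
    by simp
  have "fact n * fps_nth (G * T) n = (\<Sum>k=0..n. fact n * (fps_nth G k * fps_nth T (n - k)))"
    by (simp add: fps_mult_nth sum_distrib_left)
  also have "\<dots> = (\<Sum>k=0..n. of_nat a ^ n * (of_nat (n choose k) * Euler_poly k (of_nat c * y1) *
      (\<Sum>i=0..a - 1. (-1) ^ i * Euler_poly (n - k) (?x i)) * of_nat c ^ (n - k) * of_nat b ^ k))"
  proof (rule sum.cong[OF refl])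
    fix k assume "k \<in> {0..n}"
    then have k: "k \<le> n" by simp
    have pow: "(of_nat a :: 'a) ^ n = of_nat a ^ k * of_nat a ^ (n - k)"
      using k by (simp flip: power_add)
    show "fact n * (fps_nth G k * fps_nth T (n - k)) =
        of_nat a ^ n * (of_nat (n choose k) * Euler_poly k (of_nat c * y1) *
        (\<Sum>i=0..a - 1. (-1) ^ i * Euler_poly (n - k) (?x i)) * of_nat c ^ (n - k) * of_nat b ^ k)"
      unfolding T_nth G_def scaled_Euler_gf_def pow binomial_fact[OF k]
      by (simp add: power_mult_distrib)
  qed
  finally show ?thesis
    unfolding series by (simp add: sum_distrib_left)
qed

theorem theorem5:
  fixes w1 w2 w3 n :: nat and y1 y2 :: "'a::field_char_0"
  assumes "odd w1" and "odd w2" and "odd w3"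
  shows "let S1 = of_nat w1 ^ n * (\<Sum>k=0..n. of_nat (n choose k) * Euler_poly k (of_nat w3 * y1) *
            (\<Sum>i=0..w1 - 1. (-1) ^ i * Euler_poly (n - k) (of_nat w2 * y2 + of_nat w2 / of_nat w1 * of_nat i)) *
            of_nat w3 ^ (n - k) * of_nat w2 ^ k);
         S2 = of_nat w1 ^ n * (\<Sum>k=0..n. of_nat (n choose k) * Euler_poly k (of_nat w2 * y1) *
            (\<Sum>i=0..w1 - 1. (-1) ^ i * Euler_poly (n - k) (of_nat w3 * y2 + of_nat w3 / of_nat w1 * of_nat i)) *
            of_nat w2 ^ (n - k) * of_nat w3 ^ k);
         S3 = of_nat w2 ^ n * (\<Sum>k=0..n. of_nat (n choose k) * Euler_poly k (of_nat w3 * y1) *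
            (\<Sum>i=0..w2 - 1. (-1) ^ i * Euler_poly (n - k) (of_nat w1 * y2 + of_nat w1 / of_nat w2 * of_nat i)) *
            of_nat w3 ^ (n - k) * of_nat w1 ^ k);
         S4 = of_nat w2 ^ n * (\<Sum>k=0..n. of_nat (n choose k) * Euler_poly k (of_nat w1 * y1) *
            (\<Sum>i=0..w2 - 1. (-1) ^ i * Euler_poly (n - k) (of_nat w3 * y2 + of_nat w3 / of_nat w2 * of_nat i)) *
            of_nat w1 ^ (n - k) * of_nat w3 ^ k);
         S5 = of_nat w3 ^ n * (\<Sum>k=0..n. of_nat (n choose k) * Euler_poly k (of_nat w2 * y1) *
            (\<Sum>i=0..w3 - 1. (-1) ^ i * Euler_poly (n - k) (of_nat w1 * y2 + of_nat w1 / of_nat w3 * of_nat i)) *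
            of_nat w2 ^ (n - k) * of_nat w1 ^ k);
         S6 = of_nat w3 ^ n * (\<Sum>k=0..n. of_nat (n choose k) * Euler_poly k (of_nat w1 * y1) *
            (\<Sum>i=0..w3 - 1. (-1) ^ i * Euler_poly (n - k) (of_nat w2 * y2 + of_nat w2 / of_nat w3 * of_nat i)) *
            of_nat w1 ^ (n - k) * of_nat w2 ^ k)
     in S1 = S2 \<and> S2 = S3 \<and> S3 = S4 \<and> S4 = S5 \<and> S5 = S6"
  \<comment> \<open>Each sum becomes the common coefficient with its weights permuted; only the
    order of factors remains to be matched.\<close>
  unfolding Let_def
    Euler_poly_convolution_eq_coeff[OF assms(1)]
    Euler_poly_convolution_eq_coeff[OF assms(2)]
    Euler_poly_convolution_eq_coeff[OF assms(3)]
  by (simp add: mult_ac)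

end
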